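(* Let $R$ be a commutative ring with identity containing $\mathbb{Q}$, let $M$ be an $R$-module, and let $N\ge 2$ be an integer. For an $R$-linear map $\lambda\colon R[X_1,\ldots,X_N]\to M$ the following two properties are equivalent: (1) $\lambda\circ M_{jk}=0$ for all $j,k\in\{1,\ldots,N\}$ with $j\neq k$; (2) for each even $d\ge 0$ there is $v_d\in M$ such that for all monomials $X_1^{a_1}\cdots X_N^{a_N}$, $$\lambda(X_1^{a_1}\cdots X_N^{a_N})=\begin{cases}(a_1-1)!!\cdots(a_N-1)!!\,v_{a_1+\cdots+a_N}&\text{if all } a_j\text{ are even},\\ 0&\text{if some } a_j\text{ is odd}.\end{cases}$$ Moreover, there exists a unique spherical mean $\lambda_0$ on $R[X_1,\ldots,X_N]$ such that $\lambda_0\bigl((X_1^2+\cdots+X_N^2)^n\bigr)=1$ for all integers $n\ge 0$.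
   Context: For distinct $j,k$, $M_{jk}=X_j\partial_k-X_k\partial_j$ acting on $R[X_1,\ldots,X_N]$, where $\partial_j=\partial/\partial X_j$. A spherical mean on $R[X_1,\ldots,X_N]$ ($N\ge2$) is an $R$-linear map $\lambda\colon R[X_1,\ldots,X_N]\to R$ with $\lambda\circ M_{jk}=0$ for all $j\ne k$. Double factorial: $b!!=b(b-2)\cdots1$ for odd $b\ge1$, $b!!=b(b-2)\cdots2$ for even $b\ge2$, $0!!=1$, and $(-1)!!=1$. *)

theory Defs
  imports Complex_Main "HOL-Library.Poly_Mapping" "HOL-Library.Cardinality"
begin

text \<open>
  The polynomial ring $R[X_1,\ldots,X_N]$ is the monoid algebra of exponent vectors, with the
  variables indexed by a finite type \<open>'n\<close> whose cardinality is $N$.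
\<close>

type_synonym ('n, 'r) mvpoly = "('n \<Rightarrow>\<^sub>0 nat) \<Rightarrow>\<^sub>0 'r"

definition contains_rat :: "'r::comm_ring_1 itself \<Rightarrow> bool" where
  "contains_rat _ \<longleftrightarrow> (\<exists>\<phi> :: rat \<Rightarrow> 'r.
     inj \<phi> \<and> \<phi> 1 = 1 \<and> (\<forall>x y. \<phi> (x + y) = \<phi> x + \<phi> y) \<and> (\<forall>x y. \<phi> (x * y) = \<phi> x * \<phi> y))"

definition Var :: "'n \<Rightarrow> ('n, 'r::comm_ring_1) mvpoly" where
  "Var j = Poly_Mapping.single (Poly_Mapping.single j 1) 1"

definition poly_scale :: "'r::comm_ring_1 \<Rightarrow> ('n, 'r) mvpoly \<Rightarrow> ('n, 'r) mvpoly" where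
  "poly_scale c p = Poly_Mapping.single 0 c * p"

text \<open>
  If $X_j$ does not occur in \<open>m\<close>, the truncated subtraction leaves \<open>m\<close> unchanged, but the
  coefficient of that term is then 0.
\<close>

definition partial_deriv :: "'n \<Rightarrow> ('n, 'r::comm_ring_1) mvpoly \<Rightarrow> ('n, 'r) mvpoly" where
  "partial_deriv j p = (\<Sum>m\<in>Poly_Mapping.keys p.
     Poly_Mapping.single (m - Poly_Mapping.single j 1)
       (of_nat (Poly_Mapping.lookup m j) * Poly_Mapping.lookup p m))"

definition rot_op :: "'n \<Rightarrow> 'n \<Rightarrow> ('n, 'r::comm_ring_1) mvpoly \<Rightarrow> ('n, 'r) mvpoly" where
  "rot_op j k p = Var j * partial_deriv k p - Var k * partial_deriv j p"

definition spherical_mean :: "(('n::finite, 'r::comm_ring_1) mvpoly \<Rightarrow> 'r) \<Rightarrow> bool" where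
  "spherical_mean l \<longleftrightarrow>
     module_hom poly_scale (*) l \<and> (\<forall>j k. j \<noteq> k \<longrightarrow> l \<circ> rot_op j k = (\<lambda>_. 0))"

text \<open>The argument is an integer so that $(-1)!! = 1$ is covered.\<close>

function double_fact :: "int \<Rightarrow> nat" where
  "double_fact b = (if b \<le> 0 then 1 else nat b * double_fact (b - 2))"
  by pat_completeness auto
termination by (relation "measure nat") auto

declare double_fact.simps [simp del]

lemma module_poly_scale: "module (poly_scale :: 'r::comm_ring_1 \<Rightarrow> ('n, 'r) mvpoly \<Rightarrow> _)"
  by unfold_locales
    (simp_all add: poly_scale_def algebra_simps single_add mult_single flip: mult.assoc)

lemma partial_deriv_monomial:
  "partial_deriv j (Poly_Mapping.single m c) =
     Poly_Mapping.single (m - Poly_Mapping.single j 1) (of_nat (Poly_Mapping.lookup m j) * c)"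
  by (cases "c = 0") (simp_all add: partial_deriv_def)

end

theory Submission
  imports Defs
begin

text \<open>
  On monomials, $\lambda\circ M_{jk}=0$ amounts to $\lambda(X^c X_j)=0$ if $c_j=0$, together with
  $(d_k+1)\,\lambda(X^dX_j^2)=(d_j+1)\,\lambda(X^dX_k^2)$. Since $R$ contains \<open>\<rat>\<close>, the first
  relation kills the monomials with an odd exponent, and the second moves all exponents to a
  single variable, so that the degree $d$ part of $\lambda$ is determined by one value $v_d$.

  With $S=\sum_j X_j^2$, the map $p\mapsto\lambda(Sp)$ is again of the form (2), for the sequence
  $(d+N)\,v_{d+2}$. By induction $\lambda(S^n)=N(N+2)\cdots(N+2n-2)\,v_{2n}$, and normalising
  these values to 1 fixes all $v_{2n}$.
\<close>

section \<open>Division by positive integers, double factorials and exponent vectors\<close>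

text \<open>The inverse is the image of 1/n: an additive \<open>\<phi>\<close> with
  \<open>\<phi> 1 = 1\<close> agrees with \<open>of_nat\<close> on naturals, and multiplicativity
  does the rest.\<close>

lemma contains_rat_invertible:
  assumes "contains_rat TYPE('r::comm_ring_1)" and "n > 0"
  obtains q :: "'r::comm_ring_1" where "q * of_nat n = 1"
proof -
  obtain \<phi> :: "rat \<Rightarrow> 'r" where one: "\<phi> 1 = 1"
    and add: "\<And>x y. \<phi> (x + y) = \<phi> x + \<phi> y" and mult: "\<And>x y. \<phi> (x * y) = \<phi> x * \<phi> y"
    using assms(1) unfolding contains_rat_def by blast
  have "\<phi> 0 = 0"
    using add[of 0 0] by simp
  then have of_nat: "\<phi> (of_nat k) = of_nat k" for k
    by (induction k) (simp_all add: one add)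
  have "\<phi> (1 / of_nat n) * of_nat n = 1"
    using mult[of "1 / of_nat n" "of_nat n"] \<open>n > 0\<close> by (simp add: one of_nat)
  then show thesis
    by (rule that)
qed

text \<open>The case a = 0 is covered by the convention (-1)!! = 1.\<close>

lemma double_fact_rec: "double_fact (int (a + 2) - 1) = (a + 1) * double_fact (int a - 1)"
  by (subst double_fact.simps) (simp add: nat_add_distrib algebra_simps)

definition even_weight :: "('n::finite \<Rightarrow>\<^sub>0 nat) \<Rightarrow> nat" where
  "even_weight m = (\<Prod>j\<in>UNIV. double_fact (int (Poly_Mapping.lookup m j) - 1))"

definition total_degree :: "('n::finite \<Rightarrow>\<^sub>0 nat) \<Rightarrow> nat" where
  "total_degree m = (\<Sum>j\<in>UNIV. Poly_Mapping.lookup m j)"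

definition all_even :: "('n \<Rightarrow>\<^sub>0 nat) \<Rightarrow> bool" where
  "all_even m \<longleftrightarrow> (\<forall>j. even (Poly_Mapping.lookup m j))"

lemma even_weight_zero [simp]: "even_weight 0 = 1"
  by (simp add: even_weight_def double_fact.simps)

lemma total_degree_zero [simp]: "total_degree 0 = 0"
  by (simp add: total_degree_def)

lemma all_even_zero [simp]: "all_even 0"
  by (simp add: all_even_def)

lemma even_weight_add_two:
  "even_weight (m + Poly_Mapping.single j 2) = (Poly_Mapping.lookup m j + 1) * even_weight m"
proof -
  let ?w = "\<lambda>m i. double_fact (int (Poly_Mapping.lookup m i) - 1)"
  have "(\<Prod>i\<in>UNIV - {j}. ?w (m + Poly_Mapping.single j 2) i) = (\<Prod>i\<in>UNIV - {j}. ?w m i)"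
    by (rule prod.cong) (auto simp: lookup_add lookup_single)
  moreover have "?w (m + Poly_Mapping.single j 2) j = (Poly_Mapping.lookup m j + 1) * ?w m j"
    unfolding double_fact_rec[symmetric] by (simp add: lookup_add)
  ultimately show ?thesis
    unfolding even_weight_def by (simp add: prod.remove[of UNIV j] algebra_simps)
qed

lemma total_degree_add: "total_degree (m + m') = total_degree m + total_degree m'"
  by (simp add: total_degree_def lookup_add sum.distrib)

lemma total_degree_single [simp]: "total_degree (Poly_Mapping.single j k) = k"
  by (simp add: total_degree_def lookup_single when_def)

lemma all_even_add_two [simp]: "all_even (m + Poly_Mapping.single j 2) \<longleftrightarrow> all_even m"
  by (simp add: all_even_def lookup_add lookup_single when_def)

lemma even_total_degree: "all_even m \<Longrightarrow> even (total_degree m)"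
  by (simp add: all_even_def total_degree_def dvd_sum)

section \<open>Monomials and the rotation operators on them\<close>

lemma single_split:
  assumes "k \<le> Poly_Mapping.lookup m j"
  obtains d where "m = d + Poly_Mapping.single j (k :: nat)"
proof
  show "m = (m - Poly_Mapping.single j k) + Poly_Mapping.single j k"
    using assms by (intro poly_mapping_eqI) (auto simp: lookup_add lookup_minus lookup_single when_def)
qed

lemma Var_power: "Var j ^ k = Poly_Mapping.single (Poly_Mapping.single j k) 1"
  by (induction k) (simp_all add: Var_def mult_single single_add[symmetric])

lemma prod_monomial:
  "finite A \<Longrightarrow> (\<Prod>j\<in>A. Poly_Mapping.single (f j) (1::'r::comm_ring_1)) = Poly_Mapping.single (\<Sum>j\<in>A. f j) 1"
  by (induction A rule: finite_induct) (simp_all add: mult_single)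

lemma prod_Var_power:
  fixes m :: "'n::finite \<Rightarrow>\<^sub>0 nat"
  shows "(\<Prod>j\<in>UNIV. Var j ^ Poly_Mapping.lookup m j) = Poly_Mapping.single m (1::'r::comm_ring_1)"
proof -
  have "(\<Sum>j\<in>UNIV. Poly_Mapping.single j (Poly_Mapping.lookup m j)) = m"
    by (rule poly_mapping_eqI) (simp add: lookup_sum lookup_single when_def)
  then show ?thesis
    by (simp add: Var_power prod_monomial)
qed

lemma poly_scale_single: "poly_scale c (Poly_Mapping.single m d) = Poly_Mapping.single m (c * d)"
  by (simp add: poly_scale_def mult_single)

text \<open>Since \<open>partial_deriv\<close> is itself a sum over monomials, this reduces
  \<open>rot_op\<close> to monomials without a separate proof that it is additive.\<close>

lemma rot_op_decompose:
  "rot_op j k p = (\<Sum>m\<in>Poly_Mapping.keys p. rot_op j k (Poly_Mapping.single m (Poly_Mapping.lookup p m)))"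
  unfolding rot_op_def partial_deriv_monomial
  by (simp add: partial_deriv_def sum_subtractf sum_distrib_left)

lemma rot_op_single:
  "rot_op j k (Poly_Mapping.single m c) =
     Poly_Mapping.single (Poly_Mapping.single j 1 + (m - Poly_Mapping.single k 1)) (of_nat (Poly_Mapping.lookup m k) * c)
   - Poly_Mapping.single (Poly_Mapping.single k 1 + (m - Poly_Mapping.single j 1)) (of_nat (Poly_Mapping.lookup m j) * c)"
  by (simp add: rot_op_def partial_deriv_monomial Var_def mult_single)

lemma poly_mapping_sum_single:
  "(\<Sum>m\<in>Poly_Mapping.keys p. Poly_Mapping.single m (Poly_Mapping.lookup p m)) = p"
  by (rule poly_mapping_eqI)
    (simp add: lookup_sum lookup_single when_def in_keys_iff)

text \<open>
  Definitions inside \<open>module\<close> itself would be shadowed by their instances for \<open>real_vector\<close>.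
\<close>

locale polynomial_functional = module scale
  for scale :: "'r::comm_ring_1 \<Rightarrow> 'm::ab_group_add \<Rightarrow> 'm"
begin

section \<open>Linear maps given by their values on monomials\<close>

text \<open>A positive integer is a unit of R, so it acts injectively on every R-module.\<close>

lemma of_nat_cancel:
  assumes "contains_rat TYPE('r)" "n > 0" "scale (of_nat n) x = scale (of_nat n) y"
  shows "x = y"
proof -
  obtain q :: 'r where q: "q * of_nat n = 1"
    using contains_rat_invertible[OF assms(1,2)] .
  have "scale q (scale (of_nat n) x) = scale q (scale (of_nat n) y)"
    using assms(3) by simp
  then show ?thesis
    by (simp add: q)
qed

lemma hom_single:
  assumes "module_hom poly_scale scale l"
  shows "l (Poly_Mapping.single m c) = scale c (l (Poly_Mapping.single m 1))"
  using module_hom.scale[OF assms, of c "Poly_Mapping.single m 1"] by (simp add: poly_scale_single)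

lemma hom_expand:
  assumes "module_hom poly_scale scale l"
  shows "l p = (\<Sum>m\<in>Poly_Mapping.keys p. scale (Poly_Mapping.lookup p m) (l (Poly_Mapping.single m 1)))"
  by (subst poly_mapping_sum_single[of p, symmetric], subst module_hom.sum[OF assms])
    (rule sum.cong[OF refl], rule hom_single[OF assms])

text \<open>The polynomial ring is a free R-module on the monomials; this is the extension of
  arbitrary values on that basis.\<close>

definition linear_ext :: "(('n \<Rightarrow>\<^sub>0 nat) \<Rightarrow> 'm) \<Rightarrow> ('n, 'r) mvpoly \<Rightarrow> 'm" where
  "linear_ext f p = (\<Sum>m\<in>Poly_Mapping.keys p. scale (Poly_Mapping.lookup p m) (f m))"

text \<open>Lets the sums for p, q and p + q, whose supports differ, run over one common index
  set.\<close>

lemma linear_ext_superset: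
  assumes "finite A" "Poly_Mapping.keys p \<subseteq> A"
  shows "linear_ext f p = (\<Sum>m\<in>A. scale (Poly_Mapping.lookup p m) (f m))"
  unfolding linear_ext_def using assms
  by (intro sum.mono_neutral_left) (auto simp: in_keys_iff)

lemma linear_ext_single [simp]: "linear_ext f (Poly_Mapping.single m 1) = f m"
  by (subst linear_ext_superset[of "{m}"]) auto

lemma lookup_poly_scale:
  "Poly_Mapping.lookup (poly_scale c p) m = c * Poly_Mapping.lookup p m"
proof -
  have "poly_scale c p = (\<Sum>m\<in>Poly_Mapping.keys p. Poly_Mapping.single m (c * Poly_Mapping.lookup p m))"
    by (subst poly_mapping_sum_single[of p, symmetric])
      (simp only: poly_scale_def sum_distrib_left mult_single, simp)
  then show ?thesis
    by (simp add: lookup_sum lookup_single when_def in_keys_iff)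
qed

lemma module_hom_linear_ext:
  fixes f :: "('n \<Rightarrow>\<^sub>0 nat) \<Rightarrow> 'm"
  shows "module_hom poly_scale scale (linear_ext f)"
proof (rule module_hom.intro)
  show "module (poly_scale :: 'r \<Rightarrow> ('n, 'r) mvpoly \<Rightarrow> _)"
    by (rule module_poly_scale)
  show "module_hom_axioms poly_scale scale (linear_ext f)"
  proof
    fix p q :: "('n, 'r) mvpoly" and c :: 'r
    let ?A = "Poly_Mapping.keys p \<union> Poly_Mapping.keys q"
    have "linear_ext f (p + q) = (\<Sum>m\<in>?A. scale (Poly_Mapping.lookup (p + q) m) (f m))"
      by (rule linear_ext_superset) (auto simp: keys_add)
    also have "\<dots> = linear_ext f p + linear_ext f q"
      by (simp add: linear_ext_superset[of ?A] lookup_add scale_left_distrib sum.distrib)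
    finally show "linear_ext f (p + q) = linear_ext f p + linear_ext f q" .
    have "linear_ext f (poly_scale c p)
        = (\<Sum>m\<in>Poly_Mapping.keys p. scale (Poly_Mapping.lookup (poly_scale c p) m) (f m))"
      by (rule linear_ext_superset) (auto simp: in_keys_iff lookup_poly_scale)
    then show "linear_ext f (poly_scale c p) = scale c (linear_ext f p)"
      by (simp add: linear_ext_def lookup_poly_scale scale_sum_right)
  qed
qed (rule module_axioms)

section \<open>Functionals of the form (2) are rotation invariant\<close>

definition even_val :: "(nat \<Rightarrow> 'm) \<Rightarrow> ('n::finite \<Rightarrow>\<^sub>0 nat) \<Rightarrow> 'm" where
  "even_val v m = (if all_even m then scale (of_nat (even_weight m)) (v (total_degree m)) else 0)"

definition mean_with :: "(nat \<Rightarrow> 'm) \<Rightarrow> (('n::finite, 'r) mvpoly \<Rightarrow> 'm) \<Rightarrow> bool" where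
  "mean_with v l \<longleftrightarrow> module_hom poly_scale scale l \<and> (\<forall>m. l (Poly_Mapping.single m 1) = even_val v m)"

text \<open>Multiplication by X_j^2 preserves parities, so it only shifts the sequence by two and
  contributes one new double factorial factor. Both the exchange of X_j^2 for X_k^2 and the
  multiplication by S rest on this.\<close>

lemma even_val_add_two:
  "even_val v (m + Poly_Mapping.single j 2) =
     scale (of_nat (Poly_Mapping.lookup m j + 1)) (even_val (\<lambda>d. v (d + 2)) m)"
  by (simp add: even_val_def even_weight_add_two total_degree_add algebra_simps)

text \<open>Each of the two terms of M_jk X^m takes the value m_j m_k times the shifted value at X^m
  / (X_j X_k), or 0 if m_j or m_k is 0. This is symmetric in j and k, so the terms cancel.\<close>

lemma rotation_invariant_if_mean_with:
  fixes l :: "('n::finite, 'r) mvpoly \<Rightarrow> 'm"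
  assumes "mean_with v l" and "j \<noteq> k"
  shows "l \<circ> rot_op j k = (\<lambda>_. 0)"
proof
  fix p
  have hom: "module_hom poly_scale scale l" and val: "\<And>m. l (Poly_Mapping.single m 1) = even_val v m"
    using assms(1) by (auto simp: mean_with_def)
  have shift: "scale (of_nat (Poly_Mapping.lookup m k))
        (even_val v (Poly_Mapping.single j 1 + (m - Poly_Mapping.single k 1)))
      = (if Poly_Mapping.lookup m j = 0 \<or> Poly_Mapping.lookup m k = 0 then 0
         else scale (of_nat (Poly_Mapping.lookup m j * Poly_Mapping.lookup m k))
           (even_val (\<lambda>d. v (d + 2)) (m - Poly_Mapping.single j 1 - Poly_Mapping.single k 1)))"
    if "j \<noteq> k" for j k m
  proof -
    consider "Poly_Mapping.lookup m k = 0"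
      | "Poly_Mapping.lookup m j = 0"
      | "Poly_Mapping.lookup m j > 0" "Poly_Mapping.lookup m k > 0" by blast
    then show ?thesis
    proof cases
      case 2
      \<comment> \<open>The exponent of X_j in this monomial is exactly 1.\<close>
      then have "\<not> all_even (Poly_Mapping.single j 1 + (m - Poly_Mapping.single k 1))"
        using that by (auto simp: all_even_def lookup_add lookup_minus lookup_single intro!: exI[of _ j])
      then show ?thesis using 2 by (simp add: even_val_def)
    next
      case 3
      let ?d = "m - Poly_Mapping.single j 1 - Poly_Mapping.single k 1"
      \<comment> \<open>Both exponents are positive here, so no subtraction is truncated.\<close>
      have "Poly_Mapping.single j 1 + (m - Poly_Mapping.single k 1) = ?d + Poly_Mapping.single j 2"
        using 3 that by (intro poly_mapping_eqI)
          (auto simp: lookup_add lookup_minus lookup_single when_def)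
      moreover have "Poly_Mapping.lookup ?d j + 1 = Poly_Mapping.lookup m j"
        using 3 that by (simp add: lookup_minus lookup_single)
      ultimately show ?thesis
        using 3 by (simp only: even_val_add_two) (simp add: mult.commute)
    qed simp
  qed
  have "l (rot_op j k (Poly_Mapping.single m c)) = 0" for m c
  proof -
    have "l (rot_op j k (Poly_Mapping.single m c)) =
        scale c (scale (of_nat (Poly_Mapping.lookup m k))
          (even_val v (Poly_Mapping.single j 1 + (m - Poly_Mapping.single k 1))))
      - scale c (scale (of_nat (Poly_Mapping.lookup m j))
          (even_val v (Poly_Mapping.single k 1 + (m - Poly_Mapping.single j 1))))"
      by (simp add: rot_op_single module_hom.diff[OF hom] hom_single[OF hom, of _ "_ * _"] val mult.commute)
    also have "\<dots> = 0"
      unfolding shift[OF \<open>j \<noteq> k\<close>] shift[OF \<open>j \<noteq> k\<close>[symmetric]]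
      by (simp add: mult.commute diff_right_commute diff_diff_eq add.commute)
    finally show ?thesis .
  qed
  then show "(l \<circ> rot_op j k) p = 0"
    by (simp add: rot_op_decompose[of _ _ p] module_hom.sum[OF hom])
qed

section \<open>Rotation invariance forces the form (2)\<close>

lemma rotation_invariant_imp_mean_with:
  fixes l :: "('n::finite, 'r) mvpoly \<Rightarrow> 'm"
  assumes rat: "contains_rat TYPE('r)" and card: "CARD('n) \<ge> 2"
    and hom: "module_hom poly_scale scale l"
    and inv: "\<And>j k. j \<noteq> k \<Longrightarrow> l \<circ> rot_op j k = (\<lambda>_. 0)"
  obtains v where "mean_with v l"
proof -
  define L where "L m = l (Poly_Mapping.single m 1)" for m
  have rel: "scale (of_nat (Poly_Mapping.lookup m k)) (L (Poly_Mapping.single j 1 + (m - Poly_Mapping.single k 1)))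
      = scale (of_nat (Poly_Mapping.lookup m j)) (L (Poly_Mapping.single k 1 + (m - Poly_Mapping.single j 1)))"
    if "j \<noteq> k" for j k m
    using fun_cong[OF inv[OF that], of "Poly_Mapping.single m 1"]
    by (simp add: rot_op_single module_hom.diff[OF hom] hom_single[OF hom, of _ "of_nat _"] L_def)
  \<comment> \<open>Apply \<open>rel\<close> to X^c X_k, where c is m without its single X_j: the
    right-hand coefficient is c_j = 0, the left side is (c_k + 1) L m.\<close>
  have odd_one: "L m = 0" if one: "Poly_Mapping.lookup m j = 1" and "j \<noteq> k" for j k m
  proof -
    obtain c where c: "m = c + Poly_Mapping.single j 1"
      using single_split[of 1 m j] one by (metis order_refl)
    then have "Poly_Mapping.lookup c j = 0"
      using that by (simp add: lookup_add)
    then have "scale (of_nat (Poly_Mapping.lookup c k + 1)) (L m) = scale (of_nat (Poly_Mapping.lookup c k + 1)) 0"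
      using rel[OF \<open>j \<noteq> k\<close>, of "c + Poly_Mapping.single k 1"] \<open>j \<noteq> k\<close>
      by (simp add: c lookup_add lookup_single add.commute)
    then show ?thesis
      by (rule of_nat_cancel[OF rat, rotated]) simp
  qed
  \<comment> \<open>This is \<open>rel\<close> for the monomial X^d X_j X_k.\<close>
  have move: "scale (of_nat (Poly_Mapping.lookup d k + 1)) (L (d + Poly_Mapping.single j 2))
      = scale (of_nat (Poly_Mapping.lookup d j + 1)) (L (d + Poly_Mapping.single k 2))"
    if "j \<noteq> k" for j k d
  proof -
    let ?m = "d + Poly_Mapping.single j 1 + Poly_Mapping.single k 1"
    have "Poly_Mapping.single j 1 + (?m - Poly_Mapping.single k 1) = d + Poly_Mapping.single j 2"
      and "Poly_Mapping.single k 1 + (?m - Poly_Mapping.single j 1) = d + Poly_Mapping.single k 2"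
      by (auto intro!: poly_mapping_eqI simp: lookup_add lookup_minus lookup_single when_def)
    moreover have "Poly_Mapping.lookup ?m j = Poly_Mapping.lookup d j + 1"
      "Poly_Mapping.lookup ?m k = Poly_Mapping.lookup d k + 1"
      using that by (auto simp: lookup_add lookup_single)
    ultimately show ?thesis
      using rel[OF that, of ?m] by simp
  qed
  have odd: "L m = 0" if "odd (Poly_Mapping.lookup m j)" for j m
  proof -
    \<comment> \<open>N >= 2 provides a second variable X_k, to which squares of X_j can be moved
      until the exponent of X_j is 1.\<close>
    have "card (UNIV - {j}) \<noteq> 0"
      using card by simp
    then obtain k where "j \<noteq> k"
      by (metis Diff_iff all_not_in_conv card.empty insertI1)
    show ?thesis
      using that
    proof (induction "Poly_Mapping.lookup m j" arbitrary: m rule: less_induct)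
      case less
      show ?case
      proof (cases "Poly_Mapping.lookup m j = 1")
        case True
        then show ?thesis using odd_one \<open>j \<noteq> k\<close> by blast
      next
        case False
        then have "2 \<le> Poly_Mapping.lookup m j"
          using less.prems by (cases "Poly_Mapping.lookup m j") auto
        then obtain d where d: "m = d + Poly_Mapping.single j 2"
          by (rule single_split)
        have "L (d + Poly_Mapping.single k 2) = 0"
          using less d \<open>j \<noteq> k\<close> by (auto simp: lookup_add lookup_single)
        then have "scale (of_nat (Poly_Mapping.lookup d k + 1)) (L m) = scale (of_nat (Poly_Mapping.lookup d k + 1)) 0"
          using move[OF \<open>j \<noteq> k\<close>, of d] d by simp
        then show ?thesis
          by (rule of_nat_cancel[OF rat, rotated]) simp
      qed
    qed
  qed
  \<comment> \<open>X_i is an arbitrary variable in which all exponents get collected.\<close>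
  obtain i :: 'n where True by simp
  \<comment> \<open>The value v_d is obtained by dividing L(X_i^d) by (d-1)!!, for every d
    regardless of parity.\<close>
  have "\<exists>x. L (Poly_Mapping.single i d) = scale (of_nat (double_fact (int d - 1))) x" for d
  proof -
    have pos: "double_fact b > 0" for b
      by (induction b rule: double_fact.induct) (subst double_fact.simps, simp)
    obtain q :: 'r where q: "q * of_nat (double_fact (int d - 1)) = 1"
      using contains_rat_invertible[OF rat pos] .
    show ?thesis
      by (intro exI[of _ "scale q (L (Poly_Mapping.single i d))"]) (simp add: q mult.commute[of _ q])
  qed
  then obtain v where v: "\<And>d. L (Poly_Mapping.single i d) = scale (of_nat (double_fact (int d - 1))) (v d)"
    by metis
  have even: "L m = even_val v m" if "all_even m" for m
    using that
  \<comment> \<open>The measure is the degree in the variables other than X_i; replacing X_k^2 by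
    X_i^2 lowers it by two.\<close>
  proof (induction "total_degree m - Poly_Mapping.lookup m i" arbitrary: m rule: less_induct)
    case less
    show ?case
    proof (cases "\<exists>k. k \<noteq> i \<and> Poly_Mapping.lookup m k > 0")
      case True
      then obtain k where k: "k \<noteq> i" "Poly_Mapping.lookup m k > 0" by blast
      then have "2 \<le> Poly_Mapping.lookup m k"
        using less.prems by (auto simp: all_even_def intro!: dvd_imp_le)
      then obtain d where d: "m = d + Poly_Mapping.single k 2"
        by (rule single_split)
      \<comment> \<open>Needed for a strict decrease of the measure, which is a truncated
        difference.\<close>
      have "Poly_Mapping.lookup d i \<le> total_degree d"
        unfolding total_degree_def by (rule member_le_sum) auto
      then have "L (d + Poly_Mapping.single i 2) = even_val v (d + Poly_Mapping.single i 2)"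
        using k less.prems unfolding d
        by (intro less.hyps) (auto simp: d total_degree_add lookup_add lookup_single)
      \<comment> \<open>\<open>L\<close> satisfies \<open>move\<close>, and by
        \<open>even_val_add_two\<close> the values of \<open>even_val v\<close> obey the same
        exchange relation.\<close>
      then have "scale (of_nat (Poly_Mapping.lookup d i + 1)) (L m) =
          scale (of_nat (Poly_Mapping.lookup d i + 1)) (even_val v m)"
        using move[OF k(1), of d] by (simp add: d even_val_add_two mult.commute del: of_nat_Suc of_nat_add)
      then show ?thesis
        by (rule of_nat_cancel[OF rat, rotated]) simp
    next
      case False
      then have m: "m = Poly_Mapping.single i (Poly_Mapping.lookup m i)"
        by (intro poly_mapping_eqI) (auto simp: lookup_single when_def)
      \<comment> \<open>Every variable other than X_i contributes (-1)!! = 1.\<close>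
      have "even_weight (Poly_Mapping.single i d) = double_fact (int d - 1)" for d
        unfolding even_weight_def
        by (simp add: prod.remove[of UNIV i] lookup_single double_fact.simps[of "-1"])
      then show ?thesis
        using less.prems by (subst (asm) m, subst (1 2) m) (simp add: even_val_def v)
    qed
  qed
  have "L m = even_val v m" for m
    using even[of m] odd[of m] by (cases "all_even m") (auto simp: even_val_def all_even_def)
  then have "mean_with v l"
    using hom by (simp add: mean_with_def L_def)
  then show thesis
    by (rule that)
qed

section \<open>Values on powers of the sum of squares\<close>

text \<open>The product S X^m is the sum of the monomials X^m X_j^2, whose values carry the factors
  m_j + 1; over all j these add up to deg m + N.\<close>

lemma mean_with_times_norm:
  fixes l :: "('n::finite, 'r) mvpoly \<Rightarrow> 'm"
  assumes "mean_with v l"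
  shows "mean_with (\<lambda>d. scale (of_nat (d + CARD('n))) (v (d + 2))) (\<lambda>p. l ((\<Sum>j\<in>UNIV. Var j ^ 2) * p))"
proof -
  have hom: "module_hom poly_scale scale l" and val: "\<And>m. l (Poly_Mapping.single m 1) = even_val v m"
    using assms by (auto simp: mean_with_def)
  let ?S = "\<Sum>j\<in>UNIV. Var j ^ 2 :: ('n, 'r) mvpoly"
  have "l (?S * (p + q)) = l (?S * p) + l (?S * q)" for p q
    by (simp add: distrib_left module_hom.add[OF hom])
  moreover have "l (?S * poly_scale c p) = scale c (l (?S * p))" for c p
    using module_hom.scale[OF hom, of c "?S * p"] by (simp add: poly_scale_def mult.left_commute)
  ultimately have "module_hom poly_scale scale (\<lambda>p. l (?S * p))"
    by (intro module_hom.intro module_hom_axioms.intro module_poly_scale module_axioms)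
  moreover have "l (?S * Poly_Mapping.single m 1) =
      even_val (\<lambda>d. scale (of_nat (d + CARD('n))) (v (d + 2))) m" for m
  proof -
    have "?S * Poly_Mapping.single m 1 = (\<Sum>j\<in>UNIV. Poly_Mapping.single (m + Poly_Mapping.single j 2) 1)"
      by (simp add: sum_distrib_right Var_power mult_single add.commute)
    then have "l (?S * Poly_Mapping.single m 1) =
        (\<Sum>j\<in>UNIV. scale (of_nat (Poly_Mapping.lookup m j + 1)) (even_val (\<lambda>d. v (d + 2)) m))"
      by (simp only: module_hom.sum[OF hom] val even_val_add_two)
    also have "\<dots> = scale (of_nat (total_degree m + CARD('n))) (even_val (\<lambda>d. v (d + 2)) m)"
      by (simp add: scale_sum_left[symmetric] sum.distrib total_degree_def add.commute)
    also have "\<dots> = even_val (\<lambda>d. scale (of_nat (d + CARD('n))) (v (d + 2))) m"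
      by (simp add: even_val_def mult.commute)
    finally show ?thesis .
  qed
  ultimately show ?thesis
    by (simp add: mean_with_def)
qed

lemma mean_with_norm_power:
  fixes l :: "('n::finite, 'r) mvpoly \<Rightarrow> 'm"
  assumes "mean_with v l"
  shows "l ((\<Sum>j\<in>UNIV. Var j ^ 2) ^ n) = scale (of_nat (\<Prod>i<n. 2 * i + CARD('n))) (v (2 * n))"
  using assms
\<comment> \<open>Since S^(n+1) = S S^n, the induction hypothesis is applied to p -> l(S p) and its
  own sequence, so \<open>v\<close> and \<open>l\<close> must vary.\<close>
proof (induction n arbitrary: v l)
  case 0
  then show ?case
    by (simp add: mean_with_def even_val_def flip: single_one)
next
  case (Suc n)
  show ?case
    \<comment> \<open>The new sequence at 2n is (2n + N) v(2n + 2), which supplies the factor for i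
      = n of the product.\<close>
    using Suc.IH[OF mean_with_times_norm[OF Suc.prems]] by (simp add: mult.commute)
qed

text \<open>If all exponents are even, so is the total degree; hence the even-indexed values
  determine the functional on monomials, and linearity does so everywhere.\<close>

lemma mean_with_cong:
  fixes l l' :: "('n::finite, 'r) mvpoly \<Rightarrow> 'm"
  assumes "mean_with v l" and "mean_with v' l'" and "\<And>n. v (2 * n) = v' (2 * n)"
  shows "l = l'"
proof
  fix p
  have "even_val v m = even_val v' m" for m :: "'n \<Rightarrow>\<^sub>0 nat"
    using assms(3) even_total_degree[of m] by (auto simp: even_val_def elim!: evenE)
  then show "l p = l' p"
    using assms(1,2) hom_expand[of l p] hom_expand[of l' p] by (simp add: mean_with_def)
qed

text \<open>Translates to property (2) as the theorem states it. Because the index type is finite,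
  every function a has finite support and is thus an exponent vector.\<close>

lemma mean_with_iff:
  fixes l :: "('n::finite, 'r) mvpoly \<Rightarrow> 'm"
  assumes "module_hom poly_scale scale l"
  shows "mean_with v l \<longleftrightarrow> (\<forall>a :: 'n \<Rightarrow> nat. l (\<Prod>j\<in>UNIV. Var j ^ a j) =
     (if \<forall>j. even (a j)
      then scale (of_nat (\<Prod>j\<in>UNIV. double_fact (int (a j) - 1))) (v (\<Sum>j\<in>UNIV. a j))
      else 0))" (is "_ \<longleftrightarrow> (\<forall>a. ?P a)")
proof -
  have "mean_with v l \<longleftrightarrow> (\<forall>m. ?P (Poly_Mapping.lookup m))"
    using assms by (simp add: mean_with_def prod_Var_power even_val_def all_even_def
        even_weight_def total_degree_def)
  also have "\<dots> \<longleftrightarrow> (\<forall>a. ?P a)"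
  proof
    assume P: "\<forall>m. ?P (Poly_Mapping.lookup m)"
    show "\<forall>a. ?P a"
    proof
      fix a :: "'n \<Rightarrow> nat"
      have "Poly_Mapping.lookup (Abs_poly_mapping a) = a"
        by (simp add: Abs_poly_mapping_inverse)
      then show "?P a"
        using spec[OF P, of "Abs_poly_mapping a"] by simp
    qed
  qed blast
  finally show ?thesis .
qed

end

section \<open>The normalised spherical mean\<close>

lemma ex1_normalized_spherical_mean:
  assumes rat: "contains_rat TYPE('r::comm_ring_1)" and card: "CARD('n::finite) \<ge> 2"
  shows "\<exists>!l0 :: ('n::finite, 'r::comm_ring_1) mvpoly \<Rightarrow> 'r. spherical_mean l0 \<and>
          (\<forall>n :: nat. l0 ((\<Sum>j\<in>UNIV. Var j ^ 2) ^ n) = 1)"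
proof -
  \<comment> \<open>The module of values is now R itself.\<close>
  interpret R: polynomial_functional "(*) :: 'r \<Rightarrow> 'r \<Rightarrow> 'r"
    by unfold_locales (simp_all add: algebra_simps)
  have "\<exists>q :: 'r. q * of_nat (\<Prod>i<n. 2 * i + CARD('n)) = 1" for n
    using contains_rat_invertible[OF rat, of "\<Prod>i<n. 2 * i + CARD('n)"] by (auto simp: prod_pos)
  then obtain u :: "nat \<Rightarrow> 'r" where u: "\<And>n. u n * of_nat (\<Prod>i<n. 2 * i + CARD('n)) = 1"
    by metis
  \<comment> \<open>Chosen so that v_{2n} is the inverse of N(N+2)...(N+2n-2), which makes the value
    on S^n equal to 1.\<close>
  let ?v = "\<lambda>d. u (d div 2)"
  show ?thesis
  proof (rule ex1I)
    let ?l = "R.linear_ext (R.even_val ?v) :: ('n, 'r) mvpoly \<Rightarrow> 'r"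
    have l: "R.mean_with ?v ?l"
      by (simp add: R.mean_with_def R.module_hom_linear_ext)
    then show "spherical_mean ?l \<and> (\<forall>n. ?l ((\<Sum>j\<in>UNIV. Var j ^ 2) ^ n) = 1)"
      using R.rotation_invariant_if_mean_with[OF l] R.mean_with_norm_power[OF l] u
      by (simp add: spherical_mean_def R.mean_with_def mult.commute)
    fix l' :: "('n, 'r) mvpoly \<Rightarrow> 'r"
    assume l': "spherical_mean l' \<and> (\<forall>n. l' ((\<Sum>j\<in>UNIV. Var j ^ 2) ^ n) = 1)"
    then obtain v where v: "R.mean_with v l'"
      using R.rotation_invariant_imp_mean_with[OF rat card, of l'] by (auto simp: spherical_mean_def)
    \<comment> \<open>The normalisation makes v_{2n} an inverse of that same product, and inverses
      in R are unique.\<close>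
    have "v (2 * n) = ?v (2 * n)" for n
    proof -
      have "of_nat (\<Prod>i<n. 2 * i + CARD('n)) * v (2 * n) = 1"
        using l' R.mean_with_norm_power[OF v, of n] by simp
      then have "u n * (of_nat (\<Prod>i<n. 2 * i + CARD('n)) * v (2 * n)) = u n"
        by simp
      then show ?thesis
        unfolding mult.assoc[symmetric] u by simp
    qed
    then show "l' = ?l"
      by (rule R.mean_with_cong[OF v l])
  qed
qed

theorem proposition4p1:
  fixes scale :: "'r::comm_ring_1 \<Rightarrow> 'm::ab_group_add \<Rightarrow> 'm"
  assumes "contains_rat TYPE('r)"
    and "module scale"
    and "CARD('n::finite) \<ge> 2"
  shows "(\<forall>l :: ('n, 'r) mvpoly \<Rightarrow> 'm. module_hom poly_scale scale l \<longrightarrow>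
       ((\<forall>j k. j \<noteq> k \<longrightarrow> l \<circ> rot_op j k = (\<lambda>_. 0)) \<longleftrightarrow>
        (\<exists>v :: nat \<Rightarrow> 'm. \<forall>a :: 'n \<Rightarrow> nat.
           l (\<Prod>j\<in>UNIV. Var j ^ a j) =
             (if \<forall>j. even (a j)
              then scale (of_nat (\<Prod>j\<in>UNIV. double_fact (int (a j) - 1))) (v (\<Sum>j\<in>UNIV. a j))
              else 0))))
     \<and> (\<exists>!l0 :: ('n, 'r) mvpoly \<Rightarrow> 'r. spherical_mean l0 \<and>
          (\<forall>n :: nat. l0 ((\<Sum>j\<in>UNIV. Var j ^ 2) ^ n) = 1))"
proof (intro conjI allI impI)
  interpret M: polynomial_functional scale
    by (rule polynomial_functional.intro) fact
  fix l :: "('n, 'r) mvpoly \<Rightarrow> 'm"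
  assume hom: "module_hom poly_scale scale l"
  show "(\<forall>j k. j \<noteq> k \<longrightarrow> l \<circ> rot_op j k = (\<lambda>_. 0)) \<longleftrightarrow>
        (\<exists>v :: nat \<Rightarrow> 'm. \<forall>a :: 'n \<Rightarrow> nat.
           l (\<Prod>j\<in>UNIV. Var j ^ a j) =
             (if \<forall>j. even (a j)
              then scale (of_nat (\<Prod>j\<in>UNIV. double_fact (int (a j) - 1))) (v (\<Sum>j\<in>UNIV. a j))
              else 0))"
    \<comment> \<open>Property (2) turns into the existence of some \<open>v\<close> with
      \<open>M.mean_with v l\<close>.\<close>
    unfolding M.mean_with_iff[OF hom, symmetric]
    using M.rotation_invariant_if_mean_with M.rotation_invariant_imp_mean_with[OF assms(1,3) hom]
    by metis
qed (rule ex1_normalized_spherical_mean[OF assms(1,3)])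

end
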